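(* Let $r\le s$, let $\mathbf W_r,\mathbf V_r\in\mathbb R^{d\times r}$ and $\mathbf\Pi_r=\mathbf W_r\mathbf V_r^\top$ be defined by the leading $r$ eigenvectors of the right and left eigenvalue problems $\mathbf P\mathbf Q\mathbf W=\mathbf W\mathbf\Sigma^2$ and $\mathbf Q\mathbf P\mathbf V=\mathbf V\mathbf\Sigma^2$ (normalized by square-root balancing as in the context), where $\mathbf P=\mathbf\Gamma_{\mathrm{pr}}$ and $\mathbf Q=\mathbf G^\top\mathbf\Gamma_{\mathrm{obs}}^{-1}\mathbf G$. Let $\mathbf G_{\mathrm{OLR}}=\mathbf G\mathbf\Pi_r$ and let $$\mathbf\Gamma_{\mathrm{pos}}^{\mathrm{OLR}}=\mathbf\Gamma_{\mathrm{pr}}-\mathbf\Gamma_{\mathrm{pr}}\mathbf G_{\mathrm{OLR}}^\top(\mathbf\Gamma_{\mathrm{obs}}+\mathbf G_{\mathrm{OLR}}\mathbf\Gamma_{\mathrm{pr}}\mathbf G_{\mathrm{OLR}}^\top)^{-1}\mathbf G_{\mathrm{OLR}}\mathbf\Gamma_{\mathrm{pr}}\in\mathbb R^{d\times d},\qquad \boldsymbol\mu_{\mathrm{pos}}^{\mathrm{OLR}}=\mathbf\Gamma_{\mathrm{pos}}^{\mathrm{OLR}}\mathbf G_{\mathrm{OLR}}^\top\mathbf\Gamma_{\mathrm{obs}}^{-1}\mathbf m\in\mathbb R^d.$$ These $d$-dimensional posterior approximations are equivalent to the optimal $s$-dimensional rank-$r$ OLR (optimal low-rank) approximations $\hat{\mathbf\Gamma}_{\mathrm{pos}}^{\mathrm{OLR}}\in\mathbb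 R^{s\times s}$ and $\hat{\boldsymbol\mu}_{\mathrm{pos}}^{\mathrm{OLR}}\in\mathbb R^s$ of the restricted problem (defined in the context) in the sense that $$\mathbf W_s\hat{\mathbf\Gamma}_{\mathrm{pos}}^{\mathrm{OLR}}\mathbf W_s^\top=\mathbf\Gamma_{\mathrm{pos}}^{\mathrm{OLR}}\quad\text{and}\quad \mathbf V_s^\top\mathbf\Gamma_{\mathrm{pos}}^{\mathrm{OLR}}\mathbf V_s=\hat{\mathbf\Gamma}_{\mathrm{pos}}^{\mathrm{OLR}},$$ as well as $$\mathbf W_s\hat{\boldsymbol\mu}_{\mathrm{pos}}^{\mathrm{OLR}}=\boldsymbol\mu_{\mathrm{pos}}^{\mathrm{OLR}}\quad\text{and}\quad \mathbf V_s^\top\boldsymbol\mu_{\mathrm{pos}}^{\mathrm{OLR}}=\hat{\boldsymbol\mu}_{\mathrm{pos}}^{\mathrm{OLR}}.$$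
   Context: **Inverse problem.** Let $\mathbf G\in\mathbb R^{d_{\mathrm{obs}}\times d}$ and $\mathbf m=\mathbf G\mathbf p+\boldsymbol\epsilon\in\mathbb R^{d_{\mathrm{obs}}}$, with $\mathbf p\sim\mathcal N(\mathbf 0,\mathbf\Gamma_{\mathrm{pr}})$ and $\boldsymbol\epsilon\sim\mathcal N(\mathbf 0,\mathbf\Gamma_{\mathrm{obs}})$. Here $\mathbf\Gamma_{\mathrm{obs}}$ is symmetric positive definite, and $\mathbf\Gamma_{\mathrm{pr}}\in\mathbb R^{d\times d}$ is symmetric positive semidefinite of rank $s<d$. Put $\mathbf P=\mathbf\Gamma_{\mathrm{pr}}$ and $\mathbf Q=\mathbf G^\top\mathbf\Gamma_{\mathrm{obs}}^{-1}\mathbf G$; $\mathbf Q$ is assumed to have full rank. **Bases (square-root balancing).** Write $\mathbf P=\mathbf L\mathbf L^\top$ with $\mathbf L\in\mathbb R^{d\times s}$ and $\mathbf Q=\mathbf R\mathbf R^\top$. Let $\mathbf R^\top\mathbf L=\mathbf U_s\mathbf\Sigma_s\mathbf Z_s^\top$ be a (thin) singular value decomposition with $\mathbf\Sigma_s=\mathrm{diag}(\sigma_1,\dots,\sigma_s)$, $\sigma_1\ge\dots\ge\sigma_s>0$. Define $\mathbf W_s=\mathbf L\mathbf Z_s\mathbf\Sigma_s^{-1/2}$ and $\mathbf V_s=\mathbf R\mathbf U_s\mathbf\Sigma_s^{-1/2}$, both in $\mathbb R^{d\times s}$. Their columns are eigenvectors of $\mathbf P\mathbf Q$, respectively of $\mathbf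 Q\mathbf P$, for the nonzero eigenvalues $\sigma_i^2$, normalized so that $\mathbf V_s^\top\mathbf W_s=\mathbf I_s$ and $\mathbf V_s^\top\mathbf P\mathbf V_s=\mathbf\Sigma_s=\mathbf W_s^\top\mathbf Q\mathbf W_s$. For $r\le s$, $\mathbf W_r,\mathbf V_r\in\mathbb R^{d\times r}$ are the first $r$ columns of $\mathbf W_s,\mathbf V_s$. **Restricted problem.** Set $\hat{\mathbf G}=\mathbf G\mathbf W_s\in\mathbb R^{d_{\mathrm{obs}}\times s}$, $\hat{\mathbf p}=\mathbf V_s^\top\mathbf p$, and $\hat{\mathbf\Gamma}_{\mathrm{pr}}=\mathbf V_s^\top\mathbf\Gamma_{\mathrm{pr}}\mathbf V_s=\mathbf\Sigma_s$. The restricted measurement model is $\mathbf m=\hat{\mathbf G}\hat{\mathbf p}+\boldsymbol\epsilon$ with $\hat{\mathbf p}\sim\mathcal N(\mathbf 0,\hat{\mathbf\Gamma}_{\mathrm{pr}})$. **OLR approximations of the restricted problem.** Let $\hat{\mathbf W}\in\mathbb R^{s\times s}$ collect generalized eigenvectors, $\hat{\mathbf G}^\top\mathbf\Gamma_{\mathrm{obs}}^{-1}\hat{\mathbf G}\hat{\mathbf W}=\hat{\mathbf\Gamma}_{\mathrm{pr}}^{-1}\hat{\mathbf W}\hat{\mathbf\Sigma}^2$, with eigenvalues (the diagonal of $\hat{\mathbf\Sigma}^2$) in non-increasing order and normalization $\hat{\mathbf W}^\top\hat{\mathbf G}^\top\mathbf\Gamma_{\mathrm{obs}}^{-1}\hat{\mathbf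 G}\hat{\mathbf W}=\hat{\mathbf\Sigma}$. Let $\hat{\mathbf V}=\hat{\mathbf G}^\top\mathbf\Gamma_{\mathrm{obs}}^{-1}\hat{\mathbf G}\hat{\mathbf W}\hat{\mathbf\Sigma}^{-1}$, let $\hat{\mathbf W}_r,\hat{\mathbf V}_r$ be the first $r$ columns of $\hat{\mathbf W},\hat{\mathbf V}$, and set $\hat{\mathbf G}_{\mathrm{OLR}}=\hat{\mathbf G}\hat{\mathbf W}_r\hat{\mathbf V}_r^\top$. Then $$\hat{\mathbf\Gamma}_{\mathrm{pos}}^{\mathrm{OLR}}=(\hat{\mathbf\Gamma}_{\mathrm{pr}}^{-1}+\hat{\mathbf G}_{\mathrm{OLR}}^\top\mathbf\Gamma_{\mathrm{obs}}^{-1}\hat{\mathbf G}_{\mathrm{OLR}})^{-1},\qquad \hat{\boldsymbol\mu}_{\mathrm{pos}}^{\mathrm{OLR}}=\hat{\mathbf\Gamma}_{\mathrm{pos}}^{\mathrm{OLR}}\hat{\mathbf G}_{\mathrm{OLR}}^\top\mathbf\Gamma_{\mathrm{obs}}^{-1}\mathbf m.$$ They are called optimal because, for the restricted posterior covariance $\hat{\mathbf\Gamma}_{\mathrm{pos}}=(\hat{\mathbf\Gamma}_{\mathrm{pr}}^{-1}+\hat{\mathbf G}^\top\mathbf\Gamma_{\mathrm{obs}}^{-1}\hat{\mathbf G})^{-1}$ and mean $\hat{\boldsymbol\mu}_{\mathrm{pos}}=\hat{\mathbf\Gamma}_{\mathrm{pos}}\hat{\mathbf G}^\top\mathbf\Gamma_{\mathrm{obs}}^{-1}\mathbf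 m$, the first minimizes the Förstner distance to $\hat{\mathbf\Gamma}_{\mathrm{pos}}$ (the square root of the sum of squared logarithms of the generalized eigenvalues of the pair) over positive definite matrices $\hat{\mathbf\Gamma}_{\mathrm{pr}}-\hat{\mathbf K}_r\hat{\mathbf K}_r^\top$ with $\mathrm{rank}(\hat{\mathbf K}_r)\le r$, and the second minimizes $\mathbb E\|\hat{\boldsymbol\mu}_{\mathrm{pos}}-\hat{\boldsymbol\mu}\|^2_{\hat{\mathbf\Gamma}_{\mathrm{pos}}^{-1}}$ over $\hat{\boldsymbol\mu}=\hat{\mathbf A}_r\mathbf m$ with $\mathrm{rank}(\hat{\mathbf A}_r)\le r$, where $\|\mathbf x\|_{\mathbf M}^2=\mathbf x^\top\mathbf M\mathbf x$.
   Formalization: If σ_r = σ_{r+1} with 0 < r < s, the restricted OLR approximations depend on the choice of Ŵ and the identities can fail (s=2, r=1, Ŵ a swap); they are then stated for some admissible Ŵ, and for every admissible Ŵ when there is no such tie. *)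

theory Defs
  imports
    "HOL-Probability.Characteristic_Functions"
    "Jordan_Normal_Form.Gauss_Jordan_Elimination"
    "Jordan_Normal_Form.DL_Rank"
begin

text \<open>All matrices are real matrices of the AFP entry Jordan_Normal_Form, so that the dimensions
  are natural numbers and rows and columns are numbered from 0; the dimensions are fixed by
  \<^const>\<open>carrier_mat\<close> assumptions.\<close>

text \<open>The library inverse is an option; \<open>the\<close> turns it into a total function, which is only
  meaningful on invertible matrices.\<close>

definition inv_mat :: "real mat \<Rightarrow> real mat" where
  "inv_mat A = the (mat_inverse A)"

definition first_cols :: "nat \<Rightarrow> real mat \<Rightarrow> real mat" where
  "first_cols r A = mat_of_cols (dim_row A) (take r (cols A))"

definition sym_pos_semidef :: "nat \<Rightarrow> real mat \<Rightarrow> bool" where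
  "sym_pos_semidef n A \<longleftrightarrow> A \<in> carrier_mat n n \<and> A\<^sup>T = A \<and>
     (\<forall>x\<in>carrier_vec n. 0 \<le> scalar_prod x (A *\<^sub>v x))"

definition sym_pos_def :: "nat \<Rightarrow> real mat \<Rightarrow> bool" where
  "sym_pos_def n A \<longleftrightarrow> A \<in> carrier_mat n n \<and> A\<^sup>T = A \<and>
     (\<forall>x\<in>carrier_vec n. x \<noteq> 0\<^sub>v n \<longrightarrow> 0 < scalar_prod x (A *\<^sub>v x))"

text \<open>\<open>X \<sim> N(0, C)\<close>, for a random vector \<open>X\<close> of dimension \<open>n\<close>. It is characterised by its
  characteristic function because the covariance \<open>C\<close> may be singular, in which case there is no
  Lebesgue density.\<close>

definition centered_gaussian :: "'w measure \<Rightarrow> nat \<Rightarrow> real mat \<Rightarrow> ('w \<Rightarrow> real Matrix.vec) \<Rightarrow> bool" where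
  "centered_gaussian M n C X \<longleftrightarrow>
     (\<forall>\<omega>\<in>space M. X \<omega> \<in> carrier_vec n) \<and>
     (\<forall>i<n. (\<lambda>\<omega>. vec_index (X \<omega>) i) \<in> borel_measurable M) \<and>
     (\<forall>t\<in>carrier_vec n.
        (CLINT \<omega>|M. iexp (scalar_prod t (X \<omega>))) =
        complex_of_real (exp (- scalar_prod t (C *\<^sub>v t) / 2)))"

text \<open>A thin singular value decomposition \<open>A = U \<Sigma> Z\<^sup>T\<close> of a \<open>k \<times> s\<close> matrix of rank \<open>s\<close>, with
  \<open>\<Sigma> = diag (\<sigma> 0, \<dots>, \<sigma> (s - 1))\<close>.\<close>

definition thin_svd ::
    "nat \<Rightarrow> nat \<Rightarrow> real mat \<Rightarrow> real mat \<Rightarrow> (nat \<Rightarrow> real) \<Rightarrow> real mat \<Rightarrow> bool" where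
  "thin_svd k s A U \<sigma> Z \<longleftrightarrow>
     U \<in> carrier_mat k s \<and> Z \<in> carrier_mat s s \<and>
     U\<^sup>T * U = 1\<^sub>m s \<and> Z\<^sup>T * Z = 1\<^sub>m s \<and>
     (\<forall>i<s. 0 < \<sigma> i) \<and> (\<forall>i j. i \<le> j \<and> j < s \<longrightarrow> \<sigma> j \<le> \<sigma> i) \<and>
     A = U * mat_diag s \<sigma> * Z\<^sup>T"

text \<open>Square-root balancing: \<open>L Z \<Sigma>\<^sup>-\<^sup>1\<^sup>/\<^sup>2\<close> is \<open>balance s L Z \<sigma>\<close> and
  \<open>R U \<Sigma>\<^sup>-\<^sup>1\<^sup>/\<^sup>2\<close> is \<open>balance s R U \<sigma>\<close>.\<close>

definition balance :: "nat \<Rightarrow> real mat \<Rightarrow> real mat \<Rightarrow> (nat \<Rightarrow> real) \<Rightarrow> real mat" where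
  "balance s F B \<sigma> = F * B * mat_diag s (\<lambda>i. \<sigma> i powr (-1/2))"

text \<open>The Hessian \<open>A\<^sup>T N\<^sup>-\<^sup>1 A\<close> of the data misfit, for a forward map \<open>A\<close> and noise covariance \<open>N\<close>.\<close>

definition misfit_hessian :: "real mat \<Rightarrow> real mat \<Rightarrow> real mat" where
  "misfit_hessian N A = A\<^sup>T * inv_mat N * A"

text \<open>The two formulas for a posterior covariance, for prior covariance \<open>C\<close>, noise covariance \<open>N\<close> and
  forward map \<open>A\<close>. The first one also makes sense if \<open>C\<close> is singular.\<close>

definition post_cov :: "real mat \<Rightarrow> real mat \<Rightarrow> real mat \<Rightarrow> real mat" where
  "post_cov C N A =
     C - C * A\<^sup>T * inv_mat (N + A * C * A\<^sup>T) * A * C"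

definition post_cov_prec :: "real mat \<Rightarrow> real mat \<Rightarrow> real mat \<Rightarrow> real mat" where
  "post_cov_prec C N A = inv_mat (inv_mat C + misfit_hessian N A)"

text \<open>The posterior mean for the data \<open>m\<close>, with posterior covariance \<open>K\<close>.\<close>

definition post_mean ::
    "real mat \<Rightarrow> real mat \<Rightarrow> real mat \<Rightarrow> real Matrix.vec \<Rightarrow> real Matrix.vec" where
  "post_mean K N A m = (K * A\<^sup>T * inv_mat N) *\<^sub>v m"

text \<open>\<open>B\<close> collects generalized eigenvectors of the pair \<open>(H, C\<^sup>-\<^sup>1)\<close>, \<open>H = misfit_hessian N A\<close>, for
  the eigenvalues \<open>(\<tau> i)\<^sup>2\<close> in non-increasing order, with the normalization \<open>B\<^sup>T H B = diag \<tau>\<close>.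
  The condition on the columns is part of being an eigenvector (\<open>B = 0\<close> would satisfy the
  equations). If the eigenvalues number \<open>r - 1\<close>
  and \<open>r\<close> coincide, the span of the first \<open>r\<close> columns, and hence \<open>olr_forward\<close> below, depends on
  the choice of \<open>B\<close>.\<close>

definition olr_eigenbasis ::
    "nat \<Rightarrow> real mat \<Rightarrow> real mat \<Rightarrow> real mat \<Rightarrow> real mat \<Rightarrow> (nat \<Rightarrow> real) \<Rightarrow> bool" where
  "olr_eigenbasis s C N A B \<tau> \<longleftrightarrow>
     B \<in> carrier_mat s s \<and> (\<forall>j<s. col B j \<noteq> 0\<^sub>v s) \<and>
     misfit_hessian N A * B = inv_mat C * B * mat_diag s (\<lambda>i. (\<tau> i)\<^sup>2) \<and>
     (\<forall>i j. i \<le> j \<and> j < s \<longrightarrow> (\<tau> j)\<^sup>2 \<le> (\<tau> i)\<^sup>2) \<and>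
     B\<^sup>T * misfit_hessian N A * B = mat_diag s \<tau>"

definition olr_forward ::
    "nat \<Rightarrow> nat \<Rightarrow> real mat \<Rightarrow> real mat \<Rightarrow> real mat \<Rightarrow> (nat \<Rightarrow> real) \<Rightarrow> real mat" where
  "olr_forward s r N A B \<tau> =
     (let V = misfit_hessian N A * B * inv_mat (mat_diag s \<tau>)
      in A * first_cols r B * (first_cols r V)\<^sup>T)"

text \<open>The equivalence of an approximation in dimension \<open>d\<close> (covariance \<open>K\<close> and mean \<open>\<mu>\<close>, the latter
  as a function of the data) with one in dimension \<open>s\<close> (\<open>K'\<close>, \<open>\<mu>'\<close>), over a set \<open>D\<close> of data.\<close>

definition equivalent_posteriors ::
    "real mat \<Rightarrow> real mat \<Rightarrow> real Matrix.vec set \<Rightarrow>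
     real mat \<Rightarrow> (real Matrix.vec \<Rightarrow> real Matrix.vec) \<Rightarrow>
     real mat \<Rightarrow> (real Matrix.vec \<Rightarrow> real Matrix.vec) \<Rightarrow> bool" where
  "equivalent_posteriors W V D K \<mu> K' \<mu>' \<longleftrightarrow>
     W * K' * W\<^sup>T = K \<and> V\<^sup>T * K * V = K' \<and>
     (\<forall>m\<in>D. W *\<^sub>v \<mu>' m = \<mu> m \<and> V\<^sup>T *\<^sub>v \<mu> m = \<mu>' m)"

end

theory Submission
  imports Defs
begin

text \<open>In the balanced bases everything is diagonal: \<open>V\<^sup>T W = I\<close>, \<open>P = W \<Sigma> W\<^sup>T\<close>, and the restricted
  problem has prior covariance and misfit Hessian both equal to \<open>\<Sigma>\<close>. With \<open>E\<close> the projection onto the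
  first \<open>r\<close> coordinates, \<open>G\<^sub>O\<^sub>L\<^sub>R = G W E V\<^sup>T\<close>, and the Woodbury identity turns both posterior covariances
  into the same diagonal matrix, up to the change of coordinates by \<open>W\<close>.

  It remains to see that the restricted low-rank forward map is \<open>G W E\<close>, i.e. that \<open>E\<close> commutes with
  the matrix \<open>B\<close> of generalized eigenvectors. The eigenvalue equation reads
  \<open>(\<sigma>\<^sub>i\<^sup>2 - \<tau>\<^sub>j\<^sup>2) B\<^sub>i\<^sub>j = 0\<close>; as \<open>det B \<noteq> 0\<close>, some permutation avoids the zero entries of \<open>B\<close>, so \<open>\<tau>\<close> is
  a rearrangement of \<open>\<sigma>\<close>, hence \<open>\<tau> = \<sigma>\<close> by monotonicity, and the spectral gap forces \<open>B\<close> to be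
  block diagonal. Without a gap, \<open>B = I\<close> is still an admissible choice.\<close>

section \<open>Inverses of square matrices\<close>

text \<open>For square matrices a one-sided inverse is two-sided, so \<open>mat_inverse\<close>
  returns \<open>Some\<close> and the value under \<open>the\<close> is determined. Every evaluation
  of \<open>inv_mat\<close> below goes through this rule.\<close>

lemma inv_mat_eqI:
  assumes A: "A \<in> carrier_mat n n" and B: "B \<in> carrier_mat n n" and AB: "A * B = 1\<^sub>m n"
  shows "inv_mat A = B"
proof -
  have BA: "B * A = 1\<^sub>m n"
    using mat_mult_left_right_inverse[OF A B AB] .
  have "A \<in> Units (ring_mat TYPE(real) n ())"
    using A B AB BA unfolding Units_def ring_mat_def by auto
  then obtain C where C: "mat_inverse A = Some C"
    using mat_inverse(1)[OF A, of "()"] by (cases "mat_inverse A") auto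
  have "C * A = 1\<^sub>m n" "C \<in> carrier_mat n n"
    using mat_inverse(2)[OF A C] by auto
  then have "C = B"
    using A B AB assoc_mult_mat[of C n n A n B n] by simp
  then show ?thesis
    by (simp add: inv_mat_def C)
qed

text \<open>A nonzero kernel vector would make the quadratic form vanish, so the determinant is
  nonzero.\<close>

lemma sym_pos_def_inv_mat:
  assumes "sym_pos_def n N"
  shows "inv_mat N \<in> carrier_mat n n" "N * inv_mat N = 1\<^sub>m n" "inv_mat N * N = 1\<^sub>m n"
proof -
  have N: "N \<in> carrier_mat n n"
    and pos: "\<And>x. x \<in> carrier_vec n \<Longrightarrow> x \<noteq> 0\<^sub>v n \<Longrightarrow> 0 < scalar_prod x (N *\<^sub>v x)"
    using assms unfolding sym_pos_def_def by auto
  have "det N \<noteq> 0"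
    using pos by (fastforce simp: det_0_iff_vec_prod_zero_field[OF N])
  from det_non_zero_imp_unit[OF N this, of "()"]
  obtain B where "B \<in> carrier_mat n n" "N * B = 1\<^sub>m n" "B * N = 1\<^sub>m n"
    unfolding Units_def ring_mat_def by auto
  then show "inv_mat N \<in> carrier_mat n n" "N * inv_mat N = 1\<^sub>m n" "inv_mat N * N = 1\<^sub>m n"
    using inv_mat_eqI[OF N] by auto
qed

section \<open>Diagonal matrices and truncation to leading columns\<close>

lemma mat_diag_cong:
  "(\<And>i. i < n \<Longrightarrow> f i = g i) \<Longrightarrow> mat_diag n f = mat_diag n g"
  by (auto simp: mat_diag_def)

lemma mat_diag_eq_iff: "mat_diag n f = mat_diag n g \<longleftrightarrow> (\<forall>i<n. f i = g i)"
proof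
  assume *: "mat_diag n f = mat_diag n g"
  show "\<forall>i<n. f i = g i"
  proof (intro allI impI)
    fix i assume "i < n"
    then show "f i = g i"
      using arg_cong[OF *, of "\<lambda>A. A $$ (i, i)"] by (simp add: mat_diag_def)
  qed
qed (blast intro: mat_diag_cong)

lemma transpose_mat_diag [simp]: "(mat_diag n f)\<^sup>T = mat_diag n f"
  by (intro eq_matI) (auto simp: mat_diag_def)

lemma dim_mat_diag [simp]: "dim_row (mat_diag n f) = n" "dim_col (mat_diag n f) = n"
  by (simp_all add: mat_diag_def)

lemma inv_mat_diag:
  assumes "\<And>i. i < n \<Longrightarrow> f i \<noteq> 0"
  shows "inv_mat (mat_diag n f) = mat_diag n (\<lambda>i. 1 / f i)"
  using assms by (intro inv_mat_eqI[of _ n]) (auto simp: mat_diag_eq_iff simp flip: mat_diag_one)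

text \<open>Truncation encoded as a square diagonal matrix: the dimension stays \<open>s\<close>,
  and it multiplies entrywise with the other diagonal factors.\<close>

definition leading_proj :: "nat \<Rightarrow> nat \<Rightarrow> real mat" where
  "leading_proj s r = mat_diag s (\<lambda>i. if i < r then 1 else 0)"

lemma first_cols_mult_transpose:
  assumes A: "A \<in> carrier_mat n s" and B: "B \<in> carrier_mat k s" and r: "r \<le> s"
  shows "first_cols r A * (first_cols r B)\<^sup>T = A * leading_proj s r * B\<^sup>T"
proof (rule eq_matI)
  fix i j assume "i < dim_row (A * leading_proj s r * B\<^sup>T)" "j < dim_col (A * leading_proj s r * B\<^sup>T)"
  then have i: "i < n" and j: "j < k" using A B by auto
  have "(first_cols r A * (first_cols r B)\<^sup>T) $$ (i, j) = (\<Sum>l<r. A $$ (i, l) * B $$ (j, l))"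
    using i j A B r
    by (simp add: first_cols_def scalar_prod_def mat_of_cols_def lessThan_atLeast0)
  \<comment> \<open>The sum over the first \<open>r\<close> columns is padded with zeros to all
    \<open>s\<close> columns.\<close>
  also have "\<dots> = (\<Sum>l<s. A $$ (i, l) * (if l < r then 1 else 0) * B $$ (j, l))"
    using r by (intro sum.mono_neutral_cong_left) auto
  also have "\<dots> = (A * leading_proj s r * B\<^sup>T) $$ (i, j)"
    unfolding leading_proj_def mat_diag_mult_right[OF A]
    using i j A B by (simp add: scalar_prod_def lessThan_atLeast0)
  finally show "(first_cols r A * (first_cols r B)\<^sup>T) $$ (i, j) = (A * leading_proj s r * B\<^sup>T) $$ (i, j)" .
qed (use A B in \<open>auto simp: first_cols_def\<close>)

section \<open>Matrix algebra with premises on dimensions\<close>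

text \<open>Premises that are equations between dimensions leave no carrier set to instantiate, so
  \<open>simp only\<close> can use these rules to bring long products into right-associated
  form.\<close>

lemma mult_assoc_dim:
  fixes A B C :: "'a::semiring_0 mat"
  assumes "dim_col A = dim_row B" "dim_col B = dim_row C"
  shows "A * B * C = A * (B * C)"
  using assms by (intro assoc_mult_mat) auto

lemma transpose_mult_dim:
  fixes A B :: "'a::comm_semiring_0 mat"
  assumes "dim_col A = dim_row B"
  shows "(A * B)\<^sup>T = B\<^sup>T * A\<^sup>T"
  using assms by (intro transpose_mult) auto

lemma mat_diag_mult_mat_diag_mult:
  assumes "dim_row A = n"
  shows "mat_diag n f * (mat_diag n g * A) = mat_diag n (\<lambda>i. f i * g i) * A"
  using assms by (simp flip: mult_assoc_dim)

lemma mat_diag_plus: "mat_diag n f + mat_diag n g = mat_diag n (\<lambda>i. f i + g i :: 'a::monoid_add)"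
  by (intro eq_matI) (auto simp: mat_diag_def)

lemma mat_diag_minus: "mat_diag n f - mat_diag n g = mat_diag n (\<lambda>i. f i - g i :: 'a::group_add)"
  by (intro eq_matI) (auto simp: mat_diag_def)

lemma add_mult_distrib_dim:
  fixes A B C :: "'a::semiring_0 mat"
  assumes "dim_row A = dim_row B" "dim_col A = dim_col B" "dim_col A = dim_row C"
  shows "(A + B) * C = A * C + B * C"
  using assms by (intro add_mult_distrib_mat) auto

lemma mult_add_distrib_dim:
  fixes A B C :: "'a::semiring_0 mat"
  assumes "dim_row B = dim_row C" "dim_col B = dim_col C" "dim_col A = dim_row B"
  shows "A * (B + C) = A * B + A * C"
  using assms by (intro mult_add_distrib_mat) auto

lemma mult_minus_distrib_dim:
  fixes A B C :: "'a::ring mat"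
  assumes "dim_row B = dim_row C" "dim_col B = dim_col C" "dim_col A = dim_row B"
  shows "A * (B - C) = A * B - A * C"
  using assms by (intro mult_minus_distrib_mat) auto

lemma minus_mult_distrib_dim:
  fixes A B C :: "'a::ring mat"
  assumes "dim_row A = dim_row B" "dim_col A = dim_col B" "dim_col A = dim_row C"
  shows "(A - B) * C = A * C - B * C"
  using assms by (intro minus_mult_distrib_mat) auto

section \<open>The Woodbury identity with a diagonal core\<close>

text \<open>The premise on \<open>f\<close> and \<open>g\<close> says
  \<open>g = f / (1 + f \<sigma>)\<close> entrywise. Written without division or an inverse of
  \<open>f\<close>, it covers the entries with \<open>f i = 0\<close>, which truncation
  produces.\<close>

lemma inv_mat_woodbury:
  assumes N: "sym_pos_def n N" and A: "A \<in> carrier_mat n s"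
    and H: "misfit_hessian N A = mat_diag s \<sigma>"
    and fg: "\<And>i. i < s \<Longrightarrow> f i = g i + f i * \<sigma> i * g i"
  shows "inv_mat (N + A * mat_diag s f * A\<^sup>T)
    = inv_mat N - inv_mat N * A * mat_diag s g * A\<^sup>T * inv_mat N"
proof -
  let ?F = "mat_diag s f" and ?J = "mat_diag s g" and ?Ni = "inv_mat N"
  \<comment> \<open>The matrix to invert, multiplied by \<open>inv_mat N\<close> on the right, is
    \<open>I + Y\<close>, and the claimed inverse is \<open>inv_mat N * (I - X)\<close>. So the goal
    reduces to \<open>(I + Y) * (I - X) = I\<close>, that is, to
    \<open>X + Y * X = Y\<close>.\<close>
  define B where "B = A\<^sup>T * ?Ni"
  define X where "X = A * ?J * B"
  define Y where "Y = A * ?F * B"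
  note Ni = sym_pos_def_inv_mat[OF N]
  have Nc: "N \<in> carrier_mat n n" using N by (simp add: sym_pos_def_def)
  have dims [simp]: "dim_row N = n" "dim_col N = n" "dim_row A = n" "dim_col A = s"
    "dim_row ?Ni = n" "dim_col ?Ni = n" "dim_row B = s" "dim_col B = n"
    "dim_row X = n" "dim_col X = n" "dim_row Y = n" "dim_col Y = n"
    using Nc A Ni by (auto simp: B_def X_def Y_def)
  have BA: "B * A = mat_diag s \<sigma>"
    using H by (simp only: B_def misfit_hessian_def)
  have "Y * X = A * (?F * ((B * A) * (?J * B)))"
    by (simp only: X_def Y_def mult_assoc_dim dims dim_mat_diag index_mult_mat)
  also have "\<dots> = A * (mat_diag s (\<lambda>i. f i * (\<sigma> i * g i)) * B)"
    by (simp only: BA mat_diag_mult_mat_diag_mult dims dim_mat_diag index_mult_mat)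
  finally have "X + Y * X = A * ((?J + mat_diag s (\<lambda>i. f i * (\<sigma> i * g i))) * B)"
    by (simp only: X_def mult_assoc_dim add_mult_distrib_dim mult_add_distrib_dim
        dims dim_mat_diag index_mult_mat)
  also have "?J + mat_diag s (\<lambda>i. f i * (\<sigma> i * g i)) = ?F"
    unfolding mat_diag_plus mat_diag_eq_iff using fg by (simp add: mult.assoc)
  finally have key: "X + Y * X = Y"
    by (simp only: Y_def mult_assoc_dim dims dim_mat_diag index_mult_mat)
  have r: "?Ni * A * ?J * A\<^sup>T * ?Ni = ?Ni * X"
    by (simp only: X_def B_def mult_assoc_dim dims dim_mat_diag index_mult_mat index_transpose_mat)
  have l: "(N + A * ?F * A\<^sup>T) * ?Ni = 1\<^sub>m n + Y"
    by (simp only: Y_def B_def mult_assoc_dim dims dim_mat_diag index_mult_mat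
        index_transpose_mat add_mult_distrib_dim Ni)
  let ?M = "N + A * ?F * A\<^sup>T" and ?I = "?Ni - ?Ni * X"
  have M: "?M \<in> carrier_mat n n" and I: "?I \<in> carrier_mat n n"
    by (simp_all only: carrier_mat_def mem_Collect_eq dims index_add_mat index_minus_mat
        index_mult_mat index_transpose_mat simp_thms)
  have "?M * ?I = ?M * ?Ni - (?M * ?Ni) * X"
    by (simp only: mult_minus_distrib_dim mult_assoc_dim dims index_mult_mat index_add_mat
        index_transpose_mat)
  also have "\<dots> = (1\<^sub>m n + Y) - (X + Y * X)"
    unfolding l
    by (simp only: add_mult_distrib_dim left_mult_one_mat' dims index_mult_mat index_one_mat)
  also have "\<dots> = 1\<^sub>m n"
    unfolding key by (intro eq_matI) auto
  finally show ?thesis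
    unfolding r by (rule inv_mat_eqI[OF M I])
qed

section \<open>Posteriors in balanced coordinates\<close>

lemma mult_mult_eq:
  fixes A B C X :: "'a::semiring_0 mat"
  assumes "A * B = C" "dim_col A = dim_row B" "dim_col B = dim_row X"
  shows "A * (B * X) = C * X"
  using assms(1) mult_assoc_dim[OF assms(2,3)] by simp

lemmas dim_simps = index_mult_mat(2,3) index_transpose_mat(2,3) index_add_mat(2,3)
  index_minus_mat(2,3) index_one_mat(2,3) dim_mat_diag

lemma misfit_hessian_mult:
  assumes "dim_row (inv_mat N) = n" "dim_col (inv_mat N) = n" "dim_row A = n" "dim_col A = dim_row B"
  shows "misfit_hessian N (A * B) = B\<^sup>T * misfit_hessian N A * B"
  unfolding misfit_hessian_def
  by (simp only: mult_assoc_dim transpose_mult_dim dim_simps assms)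

text \<open>Both covariances are computed explicitly: \<open>K' = diag k\<close> and
  \<open>K = W (diag k) W\<^sup>T\<close>. Since \<open>V\<^sup>T\<close> is a left inverse of
  \<open>W\<close>, it leads back from \<open>K\<close> to \<open>K'\<close>. The premise on
  \<open>Gr'\<close> keeps this computation separate from the choice of a generalized
  eigenbasis.\<close>

lemma equivalent_posteriors_diag:
  assumes N: "sym_pos_def n N" and G: "G \<in> carrier_mat n d"
    and W: "W \<in> carrier_mat d s" and V: "V \<in> carrier_mat d s"
    and VW: "V\<^sup>T * W = 1\<^sub>m s"
    and H: "misfit_hessian N (G * W) = mat_diag s \<sigma>"
    and pos: "\<forall>i<s. 0 < \<sigma> i"
    and P: "P = W * mat_diag s \<sigma> * W\<^sup>T"
    and Gr: "Gr = G * (W * leading_proj s r * V\<^sup>T)" and Gr': "Gr' = G * W * leading_proj s r"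
    and K: "K = post_cov P N Gr" and K': "K' = post_cov_prec (mat_diag s \<sigma>) N Gr'"
    and D: "D \<subseteq> carrier_vec n"
  shows "equivalent_posteriors W V D K (post_mean K N Gr) K' (post_mean K' N Gr')"
proof -
  let ?S = "mat_diag s \<sigma>" and ?E = "leading_proj s r" and ?Ni = "inv_mat N"
  let ?A = "G * W"
  \<comment> \<open>\<open>f\<close> is the diagonal of the truncated \<open>\<Sigma>\<close>; it
    occurs both in \<open>Gr P Gr\<^sup>T\<close> and as the Hessian of \<open>Gr'\<close>.
    \<open>g\<close> is the companion of \<open>f\<close> in the Woodbury identity, and
    \<open>k\<close> below is the restricted posterior variance.\<close>
  define f where "f = (\<lambda>i. if i < r then \<sigma> i else 0)"
  define g where "g = (\<lambda>i. if i < r then \<sigma> i / (1 + (\<sigma> i)\<^sup>2) else 0)"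
  have g_eq: "g i * (1 + (\<sigma> i)\<^sup>2) = \<sigma> i" if "i < r" for i
    using that sum_power2_ge_zero[of 1 "\<sigma> i"] by (simp add: g_def add_nonneg_eq_0_iff)
  have g_0: "g i = 0" if "\<not> i < r" for i
    using that by (simp add: g_def)
  define k where "k = (\<lambda>i. 1 / (1 / \<sigma> i + f i))"
  define A where "A = ?A"
  note Ni = sym_pos_def_inv_mat[OF N]
  have Nc: "N \<in> carrier_mat n n" using N by (simp add: sym_pos_def_def)
  have Ac: "A \<in> carrier_mat n s" using G W by (simp add: A_def)
  have dims: "dim_row N = n" "dim_col N = n" "dim_row G = n" "dim_col G = d"
    "dim_row W = d" "dim_col W = s" "dim_row V = d" "dim_col V = s"
    "dim_row ?Ni = n" "dim_col ?Ni = n" "dim_row A = n" "dim_col A = s"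
    "dim_row ?E = s" "dim_col ?E = s"
    using Nc G W V Ni Ac by (auto simp: leading_proj_def)
  have GW: "G * W = A" and GWX: "dim_row X = s \<Longrightarrow> G * (W * X) = A * X" for X
    using dims by (auto simp: A_def mult_assoc_dim)
  have WG: "W\<^sup>T * G\<^sup>T = A\<^sup>T"
    by (simp only: A_def transpose_mult_dim dims)
  have HA: "misfit_hessian N A = ?S"
    using H by (simp only: A_def)
  have WV: "W\<^sup>T * V = 1\<^sub>m s"
    using arg_cong[OF VW, of transpose_mat]
    by (simp only: transpose_mult_dim dims dim_simps transpose_transpose transpose_one)
  have E: "?E\<^sup>T = ?E"
    by (simp add: leading_proj_def)
  have VWX: "V\<^sup>T * (W * X) = X" and WVX: "W\<^sup>T * (V * X) = X" if "dim_row X = s" for X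
    using mult_mult_eq[OF VW, of X] mult_mult_eq[OF WV, of X] that dims by simp_all
  have AA: "A\<^sup>T * (?Ni * A) = ?S"
    using HA unfolding misfit_hessian_def
    by (simp only: mult_assoc_dim dims dim_simps)
  have AAX: "A\<^sup>T * (?Ni * (A * X)) = ?S * X" if "dim_row X = s" for X
  proof -
    have "A\<^sup>T * (?Ni * (A * X)) = A\<^sup>T * (?Ni * A) * X"
      by (simp only: mult_assoc_dim dims dim_simps that)
    then show ?thesis by (simp only: AA)
  qed
  \<comment> \<open>Normal form: products associate to the right, \<open>G * W\<close> folds into
    \<open>A\<close>, and \<open>V\<^sup>T * W\<close> and \<open>W\<^sup>T * V\<close>
    cancel.\<close>
  note alg = mult_assoc_dim transpose_mult_dim transpose_transpose dims dim_simps E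
    GW GWX WG VWX WVX VW WV
  have GrT: "Gr\<^sup>T = V * (?E * A\<^sup>T)" and Gr_A: "Gr = A * (?E * V\<^sup>T)"
    and Gr'_A: "Gr' = A * ?E"
    by (simp_all only: Gr Gr' alg)
  have PT: "P * Gr\<^sup>T = W * (mat_diag s f * A\<^sup>T)"
    unfolding GrT P
    by (simp only: alg leading_proj_def mat_diag_mult_mat_diag_mult) (simp add: f_def if_distrib if_distribR cong: if_cong)
  have TP: "Gr * P = A * (mat_diag s f * W\<^sup>T)"
    unfolding Gr_A P
    by (simp only: alg leading_proj_def mat_diag_mult_mat_diag_mult) (simp add: f_def if_distrib if_distribR cong: if_cong)
  have "Gr * P * Gr\<^sup>T = A * mat_diag s f * A\<^sup>T"
    unfolding TP GrT
    by (simp only: alg leading_proj_def mat_diag_mult_mat_diag_mult)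
      (simp add: f_def if_distrib if_distribR cong: if_cong)
  then have "inv_mat (N + Gr * P * Gr\<^sup>T) = inv_mat (N + A * mat_diag s f * A\<^sup>T)"
    by simp
  also have "\<dots> = ?Ni - ?Ni * A * mat_diag s g * A\<^sup>T * ?Ni"
  proof (rule inv_mat_woodbury[OF N Ac HA])
    fix i assume "i < s"
    show "f i = g i + f i * \<sigma> i * g i"
      using g_eq[of i] g_0[of i] by (cases "i < r") (simp_all add: f_def algebra_simps power2_eq_square)
  qed
  finally have Y: "inv_mat (N + Gr * P * Gr\<^sup>T) = ?Ni - ?Ni * (A * (mat_diag s g * (A\<^sup>T * ?Ni)))"
    by (simp only: mult_assoc_dim dims dim_simps)
  have Pc: "dim_row P = d" "dim_col P = d" "dim_row Gr = n" "dim_col Gr = d"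
    by (simp_all only: P Gr dims dim_simps)
  have "P * Gr\<^sup>T * inv_mat (N + Gr * P * Gr\<^sup>T) * Gr * P
      = W * (mat_diag s f * A\<^sup>T) * (?Ni - ?Ni * (A * (mat_diag s g * (A\<^sup>T * ?Ni)))) * (Gr * P)"
    unfolding Y PT by (simp only: mult_assoc_dim dims dim_simps Pc)
  also have "\<dots> = W * (mat_diag s (\<lambda>i. f i * (\<sigma> i * f i) - f i * (\<sigma> i * (g i * (\<sigma> i * f i)))) * W\<^sup>T)"
    unfolding TP
    by (simp only: mult_assoc_dim dims dim_simps mult_minus_distrib_dim minus_mult_distrib_dim
        AAX mat_diag_mult_mat_diag_mult mult.assoc flip: mat_diag_minus)
  finally have "K = W * (mat_diag s (\<lambda>i. \<sigma> i - (f i * (\<sigma> i * f i) - f i * (\<sigma> i * (g i * (\<sigma> i * f i))))) * W\<^sup>T)"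
    unfolding K post_cov_def
    by (simp only: P mult_assoc_dim dims dim_simps mult_minus_distrib_dim minus_mult_distrib_dim
        flip: mat_diag_minus)
  also have "mat_diag s (\<lambda>i. \<sigma> i - (f i * (\<sigma> i * f i) - f i * (\<sigma> i * (g i * (\<sigma> i * f i))))) = mat_diag s k"
  proof (rule mat_diag_cong)
    fix i assume "i < s"
    then have "1 / \<sigma> i + \<sigma> i = (1 + (\<sigma> i)\<^sup>2) / \<sigma> i"
      using pos \<open>i < s\<close> by (simp add: add_divide_distrib power2_eq_square)
    then have "\<sigma> i / (1 + (\<sigma> i)\<^sup>2) = 1 / (1 / \<sigma> i + \<sigma> i)"
      by simp
    then have "k i = (if i < r then g i else \<sigma> i)"
      by (simp add: k_def f_def g_def)
    \<comment> \<open>With \<open>x = \<sigma> i\<close>, the relation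
      \<open>x - x * x * g i = g i\<close> is used twice:
      \<open>x - x * x * (x - x * x * g i) = x - x * x * g i = g i\<close>.\<close>
    moreover have "\<sigma> i - (\<sigma> i * (\<sigma> i * \<sigma> i) - \<sigma> i * (\<sigma> i * (g i * (\<sigma> i * \<sigma> i)))) = g i" if "i < r"
    proof -
      have *: "\<sigma> i = g i + \<sigma> i * \<sigma> i * g i"
        using g_eq[OF that] by (simp add: algebra_simps power2_eq_square)
      then have "\<sigma> i * \<sigma> i * (\<sigma> i - \<sigma> i * \<sigma> i * g i) = \<sigma> i * \<sigma> i * g i"
        by (metis add_diff_cancel_right')
      then show ?thesis using * by (simp add: algebra_simps)
    qed
    ultimately show "\<sigma> i - (f i * (\<sigma> i * f i) - f i * (\<sigma> i * (g i * (\<sigma> i * f i)))) = k i"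
      by (simp add: f_def)
  qed
  finally have Kk: "K = W * (mat_diag s k * W\<^sup>T)" .
  have "misfit_hessian N Gr' = mat_diag s f"
    unfolding Gr'_A
    by (subst misfit_hessian_mult[of _ n])
      (use Ni in \<open>simp_all only: dims HA, simp_all add: leading_proj_def f_def if_distrib if_distribR cong: if_cong\<close>)
  then have "K' = inv_mat (mat_diag s (\<lambda>i. 1 / \<sigma> i + f i))"
    unfolding K' post_cov_prec_def using pos
    by (subst inv_mat_diag) (auto simp: mat_diag_plus)
  also have "\<dots> = mat_diag s k"
    unfolding k_def
  proof (rule inv_mat_diag)
    fix i assume "i < s"
    with pos have "0 < \<sigma> i" by simp
    then have "0 < 1 / \<sigma> i + f i"
      by (simp add: f_def add_pos_pos)
    then show "1 / \<sigma> i + f i \<noteq> 0" by simp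
  qed
  finally have K'k: "K' = mat_diag s k" .
  \<comment> \<open>The posterior means are these gain matrices applied to the data, so identities
    between the matrices settle all data at once.\<close>
  let ?Q = "K * Gr\<^sup>T * ?Ni" and ?Q' = "K' * Gr'\<^sup>T * ?Ni"
  have WQ: "W * ?Q' = ?Q" and VQ: "V\<^sup>T * ?Q = ?Q'"
    unfolding Kk K'k GrT Gr'_A by (simp_all only: alg)
  have WKW: "W * K' * W\<^sup>T = K" and VKV: "V\<^sup>T * K * V = K'"
    unfolding Kk K'k by (simp_all only: alg right_mult_one_mat')
  have Q: "?Q \<in> carrier_mat d n" and Q': "?Q' \<in> carrier_mat s n"
    unfolding Kk K'k Gr'_A GrT by (intro carrier_matI; simp only: dims dim_simps)+
  have V': "V\<^sup>T \<in> carrier_mat s d" using V by simp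
  show ?thesis
    unfolding equivalent_posteriors_def post_mean_def
  proof (intro conjI ballI WKW VKV)
    fix m assume "m \<in> D"
    then have m: "m \<in> carrier_vec n" using D by auto
    show "W *\<^sub>v (?Q' *\<^sub>v m) = ?Q *\<^sub>v m" "V\<^sup>T *\<^sub>v (?Q *\<^sub>v m) = ?Q' *\<^sub>v m"
      using assoc_mult_mat_vec[OF W Q' m] assoc_mult_mat_vec[OF V' Q m] unfolding WQ VQ by (simp_all only:)
  qed
qed

section \<open>Generalized eigenbases of the restricted problem\<close>

text \<open>A sorted list is determined by its multiset. The values are negated because
  \<open>sorted\<close> means non-decreasing.\<close>

lemma antimono_permuted_eq:
  fixes f g :: "nat \<Rightarrow> real"
  assumes "\<And>i j. i \<le> j \<Longrightarrow> j < n \<Longrightarrow> f j \<le> f i" "\<And>i j. i \<le> j \<Longrightarrow> j < n \<Longrightarrow> g j \<le> g i"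
    and p: "p permutes {0..<n}" and fg: "\<And>i. i < n \<Longrightarrow> f i = g (p i)" and "i < n"
  shows "f i = g i"
proof -
  let ?f = "map (\<lambda>i. - f i) [0..<n]" and ?g = "map (\<lambda>i. - g i) [0..<n]"
  have "mset ?f = image_mset (\<lambda>i. - g (p i)) (mset_set {0..<n})"
    using fg by (auto intro!: image_mset_cong)
  also have "\<dots> = image_mset (\<lambda>i. - g i) (image_mset p (mset_set {0..<n}))"
    by (simp add: multiset.map_comp comp_def)
  also have "\<dots> = mset ?g"
    using p by (simp add: permutes_image_mset)
  finally have "mset ?f = mset ?g" .
  moreover have "sorted ?f" "sorted ?g"
    using assms(1,2) by (auto simp: sorted_iff_nth_mono)
  ultimately have "?f = ?g"
    using properties_for_sort by metis
  then show ?thesis using \<open>i < n\<close> by simp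
qed

text \<open>The normalization reads
  \<open>\<tau> j = (\<Sum>l<s. \<sigma> l * (B $$ (l, j))\<^sup>2)\<close> on the diagonal, which
  is positive because the column is nonzero. It also exhibits a left inverse of \<open>B\<close>,
  hence a two-sided one. Entry \<open>(i, j)\<close> of the eigenvalue equation compares
  \<open>(\<sigma> i)\<^sup>2\<close> with \<open>(\<tau> j)\<^sup>2\<close>, and positivity removes
  the squares.\<close>

lemma olr_eigenbasis_diagD:
  assumes eig: "olr_eigenbasis s (mat_diag s \<sigma>) N A B \<tau>"
    and H: "misfit_hessian N A = mat_diag s \<sigma>"
    and pos: "\<forall>i<s. 0 < \<sigma> i"
  shows "\<And>j. j < s \<Longrightarrow> 0 < \<tau> j"
    and "B * (mat_diag s (\<lambda>i. 1 / \<tau> i) * (B\<^sup>T * mat_diag s \<sigma>)) = 1\<^sub>m s"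
    and "\<And>i j. i < s \<Longrightarrow> j < s \<Longrightarrow> B $$ (i, j) \<noteq> 0 \<Longrightarrow> \<sigma> i = \<tau> j"
proof -
  have inv: "inv_mat (mat_diag s \<sigma>) = mat_diag s (\<lambda>i. 1 / \<sigma> i)"
    using pos by (intro inv_mat_diag) (metis less_irrefl)
  have B: "B \<in> carrier_mat s s" and nz: "\<And>j. j < s \<Longrightarrow> col B j \<noteq> 0\<^sub>v s"
    and eq: "mat_diag s \<sigma> * B = mat_diag s (\<lambda>i. 1 / \<sigma> i) * B * mat_diag s (\<lambda>i. (\<tau> i)\<^sup>2)"
    and orth: "B\<^sup>T * mat_diag s \<sigma> * B = mat_diag s \<tau>"
    using eig unfolding olr_eigenbasis_def H inv by simp_all
  show \<tau>: "0 < \<tau> j" if j: "j < s" for j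
  proof -
    obtain l where l: "l < s" "B $$ (l, j) \<noteq> 0"
      using nz[OF j] B j by (auto simp: vec_eq_iff)
    have "B\<^sup>T \<in> carrier_mat s s" using B by simp
    then have "(B\<^sup>T * mat_diag s \<sigma> * B) $$ (j, j) = (\<Sum>l<s. \<sigma> l * (B $$ (l, j))\<^sup>2)"
      using j B
      by (subst mat_diag_mult_right)
        (auto simp: scalar_prod_def lessThan_atLeast0 power2_eq_square ac_simps intro!: sum.cong)
    moreover have "(B\<^sup>T * mat_diag s \<sigma> * B) $$ (j, j) = \<tau> j"
      unfolding orth using j by (simp add: mat_diag_def)
    moreover have "0 < (\<Sum>l<s. \<sigma> l * (B $$ (l, j))\<^sup>2)"
      using pos l by (intro sum_pos2[of _ l]) (auto simp: less_imp_le)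
    ultimately show ?thesis by simp
  qed
  let ?C = "mat_diag s (\<lambda>i. 1 / \<tau> i) * (B\<^sup>T * mat_diag s \<sigma>)"
  have dims: "dim_row B = s" "dim_col B = s"
    using B by auto
  have \<tau>1: "1 / \<tau> i * \<tau> i = 1" if "i < s" for i
    using \<tau>[OF that] by simp
  have "?C * B = mat_diag s (\<lambda>i. 1 / \<tau> i) * (B\<^sup>T * mat_diag s \<sigma> * B)"
    by (simp only: mult_assoc_dim dims dim_simps)
  then have "?C * B = mat_diag s (\<lambda>i. 1 / \<tau> i * \<tau> i)"
    by (simp only: orth mat_diag_diag)
  moreover have "mat_diag s (\<lambda>i. 1 / \<tau> i * \<tau> i) = mat_diag s (\<lambda>i. 1)"
    using \<tau>1 by (rule mat_diag_cong)
  ultimately have inv: "?C * B = 1\<^sub>m s"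
    by (simp only: mat_diag_one)
  have "?C \<in> carrier_mat s s"
    by (intro carrier_matI; simp only: dims dim_simps)
  from mat_mult_left_right_inverse[OF this B inv]
  show "B * (mat_diag s (\<lambda>i. 1 / \<tau> i) * (B\<^sup>T * mat_diag s \<sigma>)) = 1\<^sub>m s" .
  show "\<sigma> i = \<tau> j" if ij: "i < s" "j < s" and "B $$ (i, j) \<noteq> 0" for i j
  proof -
    have C: "mat_diag s (\<lambda>i. 1 / \<sigma> i) * B \<in> carrier_mat s s"
      using B by (intro mult_carrier_mat[of _ s s]) simp_all
    have "\<sigma> i * B $$ (i, j) = 1 / \<sigma> i * B $$ (i, j) * (\<tau> j)\<^sup>2"
      using arg_cong[OF eq, of "\<lambda>M. M $$ (i, j)"] ij
      unfolding mat_diag_mult_right[OF C] by (simp add: mat_diag_mult_left[OF B])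
    then have "(\<sigma> i)\<^sup>2 = (\<tau> j)\<^sup>2"
      using that(3) pos[rule_format, OF ij(1)] by (simp add: field_simps power2_eq_square)
    then show ?thesis
      using \<tau>[OF ij(2)] pos[rule_format, OF ij(1)] by simp
  qed
qed

text \<open>Repeated values must be matched with their multiplicities, so a bijection between the
  indices of \<open>\<sigma>\<close> and \<open>\<tau>\<close> is extracted from
  \<open>B\<close>.\<close>

lemma olr_eigenbasis_diag_spectrum:
  assumes eig: "olr_eigenbasis s (mat_diag s \<sigma>) N A B \<tau>"
    and H: "misfit_hessian N A = mat_diag s \<sigma>"
    and pos: "\<forall>i<s. 0 < \<sigma> i"
    and mono: "\<forall>i j. i \<le> j \<and> j < s \<longrightarrow> \<sigma> j \<le> \<sigma> i"
    and i: "i < s"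
  shows "\<tau> i = \<sigma> i"
proof -
  note D = olr_eigenbasis_diagD[OF eig H pos]
  have B: "B \<in> carrier_mat s s" and \<tau>_mono: "\<And>i j. i \<le> j \<Longrightarrow> j < s \<Longrightarrow> (\<tau> j)\<^sup>2 \<le> (\<tau> i)\<^sup>2"
    using eig unfolding olr_eigenbasis_def by auto
  have "mat_diag s (\<lambda>i. 1 / \<tau> i) * (B\<^sup>T * mat_diag s \<sigma>) \<in> carrier_mat s s"
    using B by (intro mult_carrier_mat[of _ s s]) simp_all
  note det_mult[OF B this]
  also note D(2)
  finally have "det B * det (mat_diag s (\<lambda>i. 1 / \<tau> i) * (B\<^sup>T * mat_diag s \<sigma>)) = 1"
    by simp
  then have "det B \<noteq> 0" by auto
  \<comment> \<open>A nonzero determinant has a nonzero term in its Leibniz expansion.\<close>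
  then obtain p where p: "p permutes {0..<s}" and "(\<Prod>i = 0..<s. B $$ (i, p i)) \<noteq> 0"
    unfolding det_def'[OF B] by (auto elim!: sum.not_neutral_contains_not_neutral)
  from this(2) have nz: "B $$ (j, p j) \<noteq> 0" if "j < s" for j
    using that by (simp add: prod_zero_iff)
  have \<sigma>\<tau>: "\<sigma> j = \<tau> (p j)" if "j < s" for j
  proof (rule D(3)[OF that _ nz[OF that]])
    show "p j < s"
      using that permutes_in_image[OF p, of j] by simp
  qed
  have \<tau>_anti: "\<tau> j \<le> \<tau> i" if "i \<le> j" "j < s" for i j
  proof (rule power2_le_imp_le[OF \<tau>_mono[OF that]])
    show "0 \<le> \<tau> i" using D(1)[of i] that by simp
  qed
  have "\<sigma> i = \<tau> i"
    by (rule antimono_permuted_eq[where f = \<sigma> and g = \<tau> and n = s and p = p])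
      (use mono \<tau>_anti p \<sigma>\<tau> i in blast)+
  then show ?thesis ..
qed

text \<open>The restricted projection is \<open>B * E * V\<^sup>T\<close> with
  \<open>E = leading_proj s r\<close>, and \<open>V\<^sup>T\<close> is the inverse of
  \<open>B\<close>. Once \<open>E\<close> commutes with \<open>B\<close>, the two cancel and
  \<open>E\<close> remains.\<close>

lemma olr_forward_diag:
  assumes eig: "olr_eigenbasis s (mat_diag s \<sigma>) N A B \<tau>"
    and H: "misfit_hessian N A = mat_diag s \<sigma>"
    and A: "A \<in> carrier_mat n s"
    and pos: "\<forall>i<s. 0 < \<sigma> i" and r: "r \<le> s"
    and block: "\<And>i j. i < s \<Longrightarrow> j < s \<Longrightarrow> (i < r) \<noteq> (j < r) \<Longrightarrow> B $$ (i, j) = 0"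
  shows "olr_forward s r N A B \<tau> = A * leading_proj s r"
proof -
  note D = olr_eigenbasis_diagD[OF eig H pos]
  let ?S = "mat_diag s \<sigma>" and ?T = "mat_diag s (\<lambda>i. 1 / \<tau> i)"
  define V where "V = ?S * B * ?T"
  have B: "B \<in> carrier_mat s s"
    using eig unfolding olr_eigenbasis_def by auto
  have V: "V \<in> carrier_mat s s"
    using B unfolding V_def by (intro mult_carrier_mat[of _ s s]) simp_all
  have dims: "dim_row B = s" "dim_col B = s" "dim_row A = n" "dim_col A = s"
    "dim_row V = s" "dim_col V = s" "dim_row (leading_proj s r) = s" "dim_col (leading_proj s r) = s"
    using A B V by (auto simp: leading_proj_def)
  have E: "leading_proj s r \<in> carrier_mat s s" by (simp add: leading_proj_def)
  have VT: "V\<^sup>T = ?T * (B\<^sup>T * ?S)"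
    by (simp only: V_def transpose_mult_dim dims dim_simps transpose_mat_diag)
  have fc: "first_cols r B \<in> carrier_mat s r" "first_cols r V \<in> carrier_mat s r"
    using B V r by (auto simp: first_cols_def)
  have "inv_mat (mat_diag s \<tau>) = ?T"
    using D(1) by (intro inv_mat_diag) (metis less_irrefl)
  then have "olr_forward s r N A B \<tau> = A * first_cols r B * (first_cols r V)\<^sup>T"
    by (simp add: olr_forward_def H V_def)
  also have "\<dots> = A * (first_cols r B * (first_cols r V)\<^sup>T)"
    using A fc by (intro assoc_mult_mat) auto
  also have "first_cols r B * (first_cols r V)\<^sup>T = B * leading_proj s r * V\<^sup>T"
    by (rule first_cols_mult_transpose[OF B V r])
  \<comment> \<open>Entry \<open>(i, j)\<close> keeps \<open>B $$ (i, j)\<close> on the left if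
    \<open>j < r\<close> and on the right if \<open>i < r\<close>; where these conditions disagree,
    \<open>block\<close> makes the entry zero.\<close>
  also have "B * leading_proj s r = leading_proj s r * B"
    unfolding leading_proj_def mat_diag_mult_right[OF B] mat_diag_mult_left[OF B]
    using block by (intro eq_matI) auto
  also have "leading_proj s r * B * V\<^sup>T = leading_proj s r * (B * V\<^sup>T)"
    by (intro mult_assoc_dim) (simp_all only: dims dim_simps)
  also have "\<dots> = leading_proj s r"
    unfolding VT D(2) using E by simp
  finally show ?thesis .
qed

section \<open>Square-root balancing\<close>

text \<open>Substituting the decomposition of \<open>R\<^sup>T * L\<close> cancels the orthonormal
  factors and leaves diagonal matrices, for which everything follows from \<open>\<sigma> i\<close>
  times the square of \<open>h i\<close> being 1.\<close>

lemma balance_identities: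
  assumes L: "L \<in> carrier_mat d s" and R: "R \<in> carrier_mat d k"
    and svd: "thin_svd k s (R\<^sup>T * L) U \<sigma> Z"
    and W: "W = balance s L Z \<sigma>" and V: "V = balance s R U \<sigma>"
  shows "W \<in> carrier_mat d s" "V \<in> carrier_mat d s" "V\<^sup>T * W = 1\<^sub>m s"
    "W\<^sup>T * (R * R\<^sup>T) * W = mat_diag s \<sigma>" "V\<^sup>T * (L * L\<^sup>T) * V = mat_diag s \<sigma>"
    "W * mat_diag s \<sigma> * W\<^sup>T = L * L\<^sup>T"
proof -
  define h where "h i = \<sigma> i powr (- 1 / 2)" for i
  let ?S = "mat_diag s \<sigma>" and ?H = "mat_diag s h"
  have U: "U \<in> carrier_mat k s" and Z: "Z \<in> carrier_mat s s"
    and UU: "U\<^sup>T * U = 1\<^sub>m s" and ZZ: "Z\<^sup>T * Z = 1\<^sub>m s"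
    and pos: "\<And>i. i < s \<Longrightarrow> 0 < \<sigma> i" and A: "R\<^sup>T * L = U * ?S * Z\<^sup>T"
    using svd unfolding thin_svd_def by auto
  have dims: "dim_row L = d" "dim_col L = s" "dim_row R = d" "dim_col R = k"
    "dim_row U = k" "dim_col U = s" "dim_row Z = s" "dim_col Z = s"
    using L R U Z by auto
  note alg = mult_assoc_dim transpose_mult_dim transpose_transpose transpose_mat_diag dims dim_simps
  \<comment> \<open>\<open>Z\<close> is square, so its rows are orthonormal as well; for the
    \<open>k \<times> s\<close> matrix \<open>U\<close> only the columns are.\<close>
  have ZZ': "Z * Z\<^sup>T = 1\<^sub>m s"
    using mat_mult_left_right_inverse[OF _ Z ZZ] Z by simp
  have W: "W = L * (Z * ?H)" and V: "V = R * (U * ?H)"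
    unfolding W V balance_def by (simp_all only: alg flip: h_def)
  have RL: "R\<^sup>T * L = U * (?S * Z\<^sup>T)"
    using A by (simp only: alg)
  have LR: "L\<^sup>T * R = Z * (?S * U\<^sup>T)"
    using arg_cong[OF RL, of transpose_mat] by (simp only: alg)
  have RLX: "R\<^sup>T * (L * X) = U * (?S * (Z\<^sup>T * X))" if "dim_row X = s" for X
    using mult_mult_eq[OF RL, of X] that by (simp only: alg)
  have LRX: "L\<^sup>T * (R * X) = Z * (?S * (U\<^sup>T * X))" if "dim_row X = k" for X
    using mult_mult_eq[OF LR, of X] that by (simp only: alg)
  have ZX: "Z\<^sup>T * (Z * X) = X" "Z * (Z\<^sup>T * X) = X" "U\<^sup>T * (U * X) = X" if "dim_row X = s" for X
    using mult_mult_eq[OF ZZ, of X] mult_mult_eq[OF ZZ', of X] mult_mult_eq[OF UU, of X] that dims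
    by simp_all
  have h: "h i * (\<sigma> i * h i) = 1" if "i < s" for i
  proof -
    have "h i * (\<sigma> i * h i) = \<sigma> i powr 1 * (\<sigma> i powr (- 1 / 2) * \<sigma> i powr (- 1 / 2))"
      using pos[OF that] by (simp add: h_def)
    also have "\<dots> = 1"
      using pos[OF that] unfolding powr_add[symmetric] by simp
    finally show ?thesis .
  qed
  note alg' = alg mult.assoc RLX LRX ZX RL LR ZZ ZZ' UU mat_diag_mult_mat_diag_mult mat_diag_diag
  \<comment> \<open>One factor \<open>\<Sigma>\<close> between the scalings arises in
    \<open>V\<^sup>T * W\<close>, two factors in the balanced forms of \<open>R * R\<^sup>T\<close>
    and \<open>L * L\<^sup>T\<close>.\<close>
  have hh: "mat_diag s (\<lambda>i. h i * (\<sigma> i * h i)) = 1\<^sub>m s"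
    unfolding mat_diag_one[symmetric] mat_diag_eq_iff using h by simp
  have "h i * (\<sigma> i * (\<sigma> i * h i)) = \<sigma> i" if "i < s" for i
    using h[OF that] by (simp add: ac_simps)
  then have hh': "mat_diag s (\<lambda>i. h i * (\<sigma> i * (\<sigma> i * h i))) = ?S"
    by (simp add: mat_diag_eq_iff)
  show "W \<in> carrier_mat d s" "V \<in> carrier_mat d s"
    unfolding W V using L R U Z by auto
  show "V\<^sup>T * W = 1\<^sub>m s"
    unfolding W V by (simp only: alg' hh)
  show "W\<^sup>T * (R * R\<^sup>T) * W = ?S"
    unfolding W by (simp only: alg' hh')
  show "V\<^sup>T * (L * L\<^sup>T) * V = ?S"
    unfolding V by (simp only: alg' hh')
  have "W * ?S * W\<^sup>T = L * (Z * (mat_diag s (\<lambda>i. h i * (\<sigma> i * h i)) * (Z\<^sup>T * L\<^sup>T)))"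
    unfolding W by (simp only: alg mat_diag_mult_mat_diag_mult mult.assoc)
  also have "\<dots> = L * L\<^sup>T"
    unfolding hh using dims ZX(2)[of "L\<^sup>T"] by simp
  finally show "W * ?S * W\<^sup>T = L * L\<^sup>T" .
qed

section \<open>Equivalence of the full and the restricted approximations\<close>

text \<open>If \<open>\<sigma> (r - 1) = \<sigma> r\<close>, a generalized eigenbasis may rotate
  these two coordinates, which changes the restricted forward map but not \<open>G_olr\<close>.
  Hence the two claims: some eigenbasis always works, and every one does under a gap. For
  \<open>r = 0\<close> or \<open>r = s\<close> there is nothing to separate.\<close>

theorem theorem3p2:
  fixes M :: "'w measure" and p eps m :: "'w \<Rightarrow> real Matrix.vec"
    and d d_obs s r k :: nat
    and G \<Gamma>obs \<Gamma>pr Q L R U Z Ws Vs Wr Vr \<Pi>r G_olr \<Gamma>pos_olr Gh \<Gamma>prh :: "real mat"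
    and \<sigma> :: "nat \<Rightarrow> real"
  assumes "r \<le> s" and "s < d"
    and "G \<in> carrier_mat d_obs d"
    and "sym_pos_def d_obs \<Gamma>obs"
    and "sym_pos_semidef d \<Gamma>pr" and "vec_space.rank d \<Gamma>pr = s"
    and "prob_space M"
    and "centered_gaussian M d \<Gamma>pr p" and "centered_gaussian M d_obs \<Gamma>obs eps"
    and "\<And>\<omega>. \<omega> \<in> space M \<Longrightarrow> m \<omega> = G *\<^sub>v p \<omega> + eps \<omega>"
    and "Q = misfit_hessian \<Gamma>obs G" and "vec_space.rank d Q = d"
    and "L \<in> carrier_mat d s" and "\<Gamma>pr = L * L\<^sup>T"
    and "R \<in> carrier_mat d k" and "Q = R * R\<^sup>T"
    and "thin_svd k s (R\<^sup>T * L) U \<sigma> Z"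
    and "Ws = balance s L Z \<sigma>" and "Vs = balance s R U \<sigma>"
    and "Wr = first_cols r Ws" and "Vr = first_cols r Vs" and "\<Pi>r = Wr * Vr\<^sup>T"
    and "G_olr = G * \<Pi>r"
    and "\<Gamma>pos_olr = post_cov \<Gamma>pr \<Gamma>obs G_olr"
    and "Gh = G * Ws" and "\<Gamma>prh = Vs\<^sup>T * \<Gamma>pr * Vs"
  defines "equiv_for \<equiv> \<lambda>What \<sigma>hat.
      let Gh_olr = olr_forward s r \<Gamma>obs Gh What \<sigma>hat;
          \<Gamma>posh_olr = post_cov_prec \<Gamma>prh \<Gamma>obs Gh_olr
      in equivalent_posteriors Ws Vs (m ` space M)
           \<Gamma>pos_olr (post_mean \<Gamma>pos_olr \<Gamma>obs G_olr)
           \<Gamma>posh_olr (post_mean \<Gamma>posh_olr \<Gamma>obs Gh_olr)"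
  shows "(\<exists>What \<sigma>hat. olr_eigenbasis s \<Gamma>prh \<Gamma>obs Gh What \<sigma>hat \<and> equiv_for What \<sigma>hat) \<and>
    ((0 < r \<and> r < s \<longrightarrow> \<sigma> r < \<sigma> (r - 1)) \<longrightarrow>
      (\<forall>What \<sigma>hat. olr_eigenbasis s \<Gamma>prh \<Gamma>obs Gh What \<sigma>hat \<longrightarrow> equiv_for What \<sigma>hat))"
proof -
  note N = assms(4)
  have L: "L \<in> carrier_mat d s" and R: "R \<in> carrier_mat d k" and G: "G \<in> carrier_mat d_obs d"
    and r: "r \<le> s" and svd: "thin_svd k s (R\<^sup>T * L) U \<sigma> Z"
    using assms by auto
  have pos: "\<forall>i<s. 0 < \<sigma> i"
    using svd by (auto simp: thin_svd_def)
  have mono: "\<forall>i j. i \<le> j \<and> j < s \<longrightarrow> \<sigma> j \<le> \<sigma> i"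
    using svd by (auto simp: thin_svd_def)
  note bal = balance_identities[OF L R svd \<open>Ws = balance s L Z \<sigma>\<close> \<open>Vs = balance s R U \<sigma>\<close>]
  have P: "\<Gamma>pr = Ws * mat_diag s \<sigma> * Ws\<^sup>T"
    using bal(6) \<open>\<Gamma>pr = L * L\<^sup>T\<close> by simp
  have Ph: "\<Gamma>prh = mat_diag s \<sigma>"
    using bal(5) assms(14) \<open>\<Gamma>prh = Vs\<^sup>T * \<Gamma>pr * Vs\<close> by simp
  have Nc: "\<Gamma>obs \<in> carrier_mat d_obs d_obs"
    using N by (simp add: sym_pos_def_def)
  have "misfit_hessian \<Gamma>obs (G * Ws) = Ws\<^sup>T * misfit_hessian \<Gamma>obs G * Ws"
    using Nc G bal(1) sym_pos_def_inv_mat(1)[OF N] by (intro misfit_hessian_mult[of _ d_obs]) auto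
  also have "\<dots> = mat_diag s \<sigma>"
    using bal(4) assms(11,16) by simp
  finally have H: "misfit_hessian \<Gamma>obs (G * Ws) = mat_diag s \<sigma>" .
  have GW: "G * Ws \<in> carrier_mat d_obs s" using G bal(1) by simp
  have Gr: "G_olr = G * (Ws * leading_proj s r * Vs\<^sup>T)"
    using first_cols_mult_transpose[OF bal(1,2) r] assms by simp
  have data: "m ` space M \<subseteq> carrier_vec d_obs"
  proof
    fix x assume "x \<in> m ` space M"
    then obtain \<omega> where \<omega>: "\<omega> \<in> space M" "x = m \<omega>" by auto
    then have "p \<omega> \<in> carrier_vec d" "eps \<omega> \<in> carrier_vec d_obs"
      using assms(8,9) by (auto simp: centered_gaussian_def)
    then show "x \<in> carrier_vec d_obs" using \<omega> G assms(10) by auto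
  qed
  \<comment> \<open>The equivalence depends on the eigenbasis only through its block structure with
    respect to the first \<open>r\<close> coordinates.\<close>
  have equiv: "equiv_for B \<tau>"
    if "olr_eigenbasis s \<Gamma>prh \<Gamma>obs Gh B \<tau>"
      and "\<And>i j. i < s \<Longrightarrow> j < s \<Longrightarrow> (i < r) \<noteq> (j < r) \<Longrightarrow> B $$ (i, j) = 0" for B \<tau>
  proof -
    have "olr_forward s r \<Gamma>obs Gh B \<tau> = G * Ws * leading_proj s r"
      using olr_forward_diag[OF _ H GW pos r that(2)] that(1) assms(25) Ph by simp
    from equivalent_posteriors_diag[OF N G bal(1-3) H pos P Gr this
        \<open>\<Gamma>pos_olr = post_cov \<Gamma>pr \<Gamma>obs G_olr\<close> refl data]
    show ?thesis
      unfolding equiv_for_def Let_def Ph .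
  qed
  \<comment> \<open>Prior covariance and Hessian are both \<open>\<Sigma>\<close>, so the unit
    vectors are generalized eigenvectors for the eigenvalues
    \<open>(\<sigma> i)\<^sup>2\<close>.\<close>
  have one: "olr_eigenbasis s \<Gamma>prh \<Gamma>obs Gh (1\<^sub>m s) \<sigma>"
  proof -
    have "inv_mat (mat_diag s \<sigma>) = mat_diag s (\<lambda>i. 1 / \<sigma> i)"
      using pos by (intro inv_mat_diag) (metis less_irrefl)
    moreover have "mat_diag s (\<lambda>i. 1 / \<sigma> i * (\<sigma> i)\<^sup>2) = mat_diag s \<sigma>"
      unfolding mat_diag_eq_iff using pos by (auto simp: power2_eq_square)
    moreover have "mat_diag s f * 1\<^sub>m s = mat_diag s f" "1\<^sub>m s * mat_diag s f = mat_diag s f"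
      for f :: "nat \<Rightarrow> real"
      by (simp_all add: right_mult_one_mat' left_mult_one_mat')
    moreover have "(\<sigma> j)\<^sup>2 \<le> (\<sigma> i)\<^sup>2" if "i \<le> j" "j < s" for i j
      using mono pos that by (intro power_mono) (simp_all add: less_imp_le)
    ultimately show ?thesis
      unfolding olr_eigenbasis_def \<open>Gh = G * Ws\<close> H Ph by (simp add: unit_vec_nonzero)
  qed
  moreover have "equiv_for (1\<^sub>m s) \<sigma>"
    by (rule equiv[OF one]) auto
  moreover have "equiv_for B \<tau>"
    if gap: "0 < r \<and> r < s \<longrightarrow> \<sigma> r < \<sigma> (r - 1)" and eig: "olr_eigenbasis s \<Gamma>prh \<Gamma>obs Gh B \<tau>" for B \<tau>
  \<comment> \<open>A nonzero entry outside the blocks would give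
    \<open>\<sigma> i = \<tau> j = \<sigma> j\<close> with \<open>i\<close> and \<open>j\<close> on
    different sides of \<open>r\<close>.\<close>
  proof (rule equiv[OF eig], rule ccontr)
    fix i j assume ij: "i < s" "j < s" "(i < r) \<noteq> (j < r)" and nz: "B $$ (i, j) \<noteq> 0"
    have eig': "olr_eigenbasis s (mat_diag s \<sigma>) \<Gamma>obs (G * Ws) B \<tau>"
      using eig Ph \<open>Gh = G * Ws\<close> by simp
    have eq: "\<sigma> i = \<sigma> j"
      using olr_eigenbasis_diagD(3)[OF eig' H pos ij(1,2) nz]
        olr_eigenbasis_diag_spectrum[OF eig' H pos mono ij(2)] by simp
    \<comment> \<open>Monotonicity extends the gap between \<open>r - 1\<close> and \<open>r\<close>
      to all pairs that \<open>r\<close> separates; such a pair forces \<open>0 < r\<close> and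
      \<open>r < s\<close>.\<close>
    have gap': "\<sigma> b < \<sigma> a" if "a < r" "r \<le> b" "b < s" for a b
    proof -
      have "a \<le> r - 1" "r - 1 < s" "0 < r" "r < s" using that by auto
      then have "\<sigma> (r - 1) \<le> \<sigma> a" "\<sigma> b \<le> \<sigma> r" "\<sigma> r < \<sigma> (r - 1)"
        using mono gap that by blast+
      then show ?thesis by linarith
    qed
    show False
      using ij eq gap'[of i j] gap'[of j i] by (cases "i < r") auto
  qed
  ultimately show ?thesis by blast
qed
end
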